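(* Let $m \geq 2$, $n \geq 1$ and $k \geq 0$ be integers. Then $$\vert\mathrm{Inc}_k(m\times n)\vert = \sum_{\ell=k}^{(m-1)(n-1)} \binom{\ell}{k} \, N(m,n,\ell).$$
   Context: For a partition $\lambda$ of $N$, an increasing $\lambda$-tableau is a filling of the Young diagram of $\lambda$ with positive integers such that rows (left to right) and columns (top to bottom) are strictly increasing and, if $N-k$ is the largest entry, every integer $i$ with $1\le i\le N-k$ appears at least once. $\mathrm{Inc}_k(\lambda)$ denotes the set of increasing $\lambda$-tableaux with maximum entry $N-k$, and $\mathrm{Inc}_k(m\times n)=\mathrm{Inc}_k(n^m)$ is the case of the rectangular shape with $m$ rows and $n$ columns ($N=mn$). Let $\mathcal{C}(m,n)$ be the set of lattice paths in $\mathbb{R}^m$ from $(0,\dots,0)$ to $(n,\dots,n)$ using unit steps $X_1=(1,0,\dots,0),\dots,X_m=(0,\dots,0,1)$ and staying in the region $\{(x_1,\dots,x_m): 0\le x_m\le x_{m-1}\le\cdots\le x_1\}$. For a path $P=\epsilon_1\cdots\epsilon_{mn}$, an ascent is an index $i$ with $\epsilon_{i-1}\epsilon_i=X_jX_r$ and $r<j$. For $m\ge 2$ and $0\le \ell\le (m-1)(n-1)$, the $m$-Narayana number $N(m,n,\ell)$ is the number of paths in $\mathcal{C}(m,n)$ with exactly $\ell$ ascents. *)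

theory Defs
  imports Main "HOL-Library.FuncSet"
begin

text \<open>A partition is given by the list of its parts in weakly decreasing order. Rows and columns
  of Young diagrams are numbered from 0.\<close>

definition young_diagram :: "nat list \<Rightarrow> (nat \<times> nat) set" where
  "young_diagram lam = {(i, j). i < length lam \<and> j < lam ! i}"

definition entries :: "nat list \<Rightarrow> (nat \<times> nat \<Rightarrow> nat) \<Rightarrow> nat set" where
  "entries lam T = T ` young_diagram lam"

text \<open>Entries of tableaux are positive, so inserting 0 affects the maximum only for the empty
  diagram.\<close>

definition max_entry :: "nat list \<Rightarrow> (nat \<times> nat \<Rightarrow> nat) \<Rightarrow> nat" where
  "max_entry lam T = Max (insert 0 (entries lam T))"

text \<open>Fillings are extensional functions on the diagram, so that distinct functions are distinct
  fillings.\<close>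

definition increasing_tableau :: "nat list \<Rightarrow> (nat \<times> nat \<Rightarrow> nat) \<Rightarrow> bool" where
  "increasing_tableau lam T \<longleftrightarrow>
     T \<in> young_diagram lam \<rightarrow>\<^sub>E {1..} \<and>
     (\<forall>i j j'. (i, j) \<in> young_diagram lam \<and> (i, j') \<in> young_diagram lam \<and> j < j'
        \<longrightarrow> T (i, j) < T (i, j')) \<and>
     (\<forall>i i' j. (i, j) \<in> young_diagram lam \<and> (i', j) \<in> young_diagram lam \<and> i < i'
        \<longrightarrow> T (i, j) < T (i', j)) \<and>
     (\<forall>v. 1 \<le> v \<and> v \<le> max_entry lam T \<longrightarrow> v \<in> entries lam T)"

text \<open>The condition that the maximum entry is \<open>N - k\<close>, where \<open>N = sum_list lam\<close>, is written
  additively to avoid truncated subtraction.\<close>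

definition Inc :: "nat \<Rightarrow> nat list \<Rightarrow> (nat \<times> nat \<Rightarrow> nat) set" where
  "Inc k lam = {T. increasing_tableau lam T \<and> max_entry lam T + k = sum_list lam}"

definition Inc_rect :: "nat \<Rightarrow> nat \<Rightarrow> nat \<Rightarrow> (nat \<times> nat \<Rightarrow> nat) set" where
  "Inc_rect k m n = Inc k (replicate m n)"

text \<open>Points of \<open>\<int>\<^sup>m\<close> are functions read at the coordinates \<open>1, \<dots>, m\<close>. A path is the list of the
  indices \<open>j\<close> of its steps \<open>X\<^sub>j\<close>.\<close>

definition unit_step :: "nat \<Rightarrow> nat \<Rightarrow> int" where
  "unit_step j = (\<lambda>r. if r = j then 1 else 0)"

definition path_end :: "nat list \<Rightarrow> nat \<Rightarrow> int" where
  "path_end P = (\<lambda>r. \<Sum>j\<leftarrow>P. unit_step j r)"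

definition in_region :: "nat \<Rightarrow> (nat \<Rightarrow> int) \<Rightarrow> bool" where
  "in_region m x \<longleftrightarrow> 0 \<le> x m \<and> (\<forall>j. 1 \<le> j \<and> j < m \<longrightarrow> x (Suc j) \<le> x j)"

text \<open>The region is convex, so a path stays in it iff all of its vertices, the ends of its initial
  segments, do.\<close>

definition lattice_paths :: "nat \<Rightarrow> nat \<Rightarrow> nat list set" where
  "lattice_paths m n = {P. set P \<subseteq> {1..m} \<and>
     (\<forall>r\<in>{1..m}. path_end P r = int n) \<and>
     (\<forall>i\<le>length P. in_region m (path_end (take i P)))}"

text \<open>List positions start at 0; the first step has no predecessor.\<close>

definition ascents :: "nat list \<Rightarrow> nat set" where
  "ascents P = {i. 0 < i \<and> i < length P \<and> P ! i < P ! (i - 1)}"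

definition narayana :: "nat \<Rightarrow> nat \<Rightarrow> nat \<Rightarrow> nat" where
  "narayana m n l = card {P \<in> lattice_paths m n. card (ascents P) = l}"

end

theory Submission
  imports Defs
begin

text \<open>The rows containing a given entry \<open>v\<close> of an increasing tableau form a set, since entries do not
  repeat within a row. Writing these sets as decreasing words of row numbers and concatenating them
  for \<open>v = 1, 2, \<dots>\<close> gives a lattice path; decreasing order turns strictness of the columns into the
  condition that the path stays in the region. Conversely, a tableau is recovered from a path
  together with a way of cutting it into decreasing blocks, i.e. a choice of the ascents that are
  not cut, and leaving \<open>k\<close> of them uncut gives maximum entry \<open>m n - k\<close>. The upper summation bound
  holds because a tableau with all ascents uncut still has maximum entry at least \<open>m + n - 1\<close>.\<close>

section \<open>Cutting a word into decreasing blocks\<close>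

definition decreasing_blocks :: "nat list list \<Rightarrow> bool" where
  "decreasing_blocks Ls \<longleftrightarrow> (\<forall>L\<in>set Ls. L \<noteq> [] \<and> sorted_wrt (>) L)"

text \<open>\<open>k\<close> counts the gaps left uncut: for nonempty \<open>P\<close>,
  \<open>length P - k\<close> blocks need \<open>length P - k - 1\<close> cuts among
  \<open>length P - 1\<close> gaps. An uncut gap lies inside a decreasing block, so it is an
  ascent.\<close>

definition block_cuts :: "nat \<Rightarrow> nat list \<Rightarrow> nat list list set" where
  "block_cuts k P = {Ls. decreasing_blocks Ls \<and> concat Ls = P \<and> length Ls + k = length P}"

lemma decreasing_blocks_simps [simp]:
  "decreasing_blocks []"
  "decreasing_blocks (L # Ls) \<longleftrightarrow> L \<noteq> [] \<and> sorted_wrt (>) L \<and> decreasing_blocks Ls"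
  "decreasing_blocks (Ls @ Ls') \<longleftrightarrow> decreasing_blocks Ls \<and> decreasing_blocks Ls'"
  by (auto simp: decreasing_blocks_def)

lemma length_le_length_concat:
  "decreasing_blocks Ls \<Longrightarrow> length Ls \<le> length (concat Ls)"
proof (induction Ls)
  case (Cons L Ls)
  then show ?case by (cases L) auto
qed simp

lemma finite_ascents [simp]: "finite (ascents P)"
  by (rule finite_subset[of _ "{..<length P}"]) (auto simp: ascents_def)

lemma card_ascents_Cons_Cons:
  "card (ascents (x # y # P)) = card (ascents (y # P)) + (if y < x then 1 else 0)"
proof -
  have "ascents (x # y # P) = Suc ` ascents (y # P) \<union> (if y < x then {1} else {})"
  proof (intro set_eqI)
    fix i
    show "i \<in> ascents (x # y # P) \<longleftrightarrow> i \<in> Suc ` ascents (y # P) \<union> (if y < x then {1} else {})"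
    proof (cases i)
      case 0
      then show ?thesis by (auto simp: ascents_def)
    next
      case (Suc i')
      then show ?thesis by (cases i') (auto simp: ascents_def image_iff)
    qed
  qed
  moreover have "1 \<notin> Suc ` ascents (y # P)" by (auto simp: ascents_def)
  ultimately show ?thesis by (simp add: card_image)
qed

lemma finite_block_cuts [simp]: "finite (block_cuts k P)"
proof (rule finite_subset)
  show "block_cuts k P \<subseteq>
    {Ls. set Ls \<subseteq> {L. set L \<subseteq> set P \<and> length L \<le> length P} \<and> length Ls \<le> length P}"
  proof
    fix Ls assume "Ls \<in> block_cuts k P"
    then have "concat Ls = P" "length Ls \<le> length P" by (auto simp: block_cuts_def)
    moreover have "length L \<le> length (concat Ls)" if "L \<in> set Ls" for L
      using that by (induction Ls) auto
    ultimately show "Ls \<in> {Ls. set Ls \<subseteq> {L. set L \<subseteq> set P \<and> length L \<le> length P} \<and> length Ls \<le> length P}"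
      by auto
  qed
qed (intro finite_lists_length_le finite_set)

text \<open>Either \<open>x\<close> is a block of its own, or it is put in front of the first block
  of a cutting of \<open>y # P\<close>. The second needs a descent in value and lengthens the word
  without adding a block, so \<open>k\<close> grows by one.\<close>

lemma block_cuts_Cons_Cons:
  "block_cuts k (x # y # P) = (#) [x] ` block_cuts k (y # P) \<union>
     (if y < x \<and> k > 0 then (\<lambda>Ls. (x # hd Ls) # tl Ls) ` block_cuts (k - 1) (y # P) else {})"
  (is "_ = ?A \<union> ?B")
proof (intro equalityI subsetI)
  fix Ls assume Ls: "Ls \<in> block_cuts k (x # y # P)"
  then obtain L Ls' where eq: "Ls = L # Ls'" by (cases Ls) (auto simp: block_cuts_def)
  with Ls obtain L' where L: "L = x # L'" by (cases L) (auto simp: block_cuts_def)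
  show "Ls \<in> ?A \<union> ?B"
  proof (cases L')
    case Nil
    then show ?thesis using Ls by (auto simp: block_cuts_def eq L)
  next
    case (Cons z L'')
    have z: "z = y" "y < x" using Ls Cons by (auto simp: block_cuts_def eq L)
    \<comment> \<open>Removing \<open>x\<close> keeps the number of blocks but shortens the word;
      there are then too many blocks unless \<open>k > 0\<close>.\<close>
    have "length (L' # Ls') \<le> length (concat (L' # Ls'))"
      by (rule length_le_length_concat) (use Ls Cons in \<open>auto simp: block_cuts_def eq L\<close>)
    moreover have "concat (L' # Ls') = y # P" using Ls by (auto simp: block_cuts_def eq L)
    ultimately have "length (L' # Ls') \<le> length (y # P)" by metis
    with Ls have "k > 0" by (auto simp: block_cuts_def eq L)
    moreover from this have "L' # Ls' \<in> block_cuts (k - 1) (y # P)"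
      using Ls Cons by (auto simp: block_cuts_def eq L)
    moreover have "Ls = (x # hd (L' # Ls')) # tl (L' # Ls')" by (simp add: eq L)
    ultimately have "Ls \<in> ?B" using z image_eqI[of Ls "\<lambda>Ls. (x # hd Ls) # tl Ls" "L' # Ls'"]
      by (simp only: simp_thms if_True)
    then show ?thesis ..
  qed
next
  fix Ls assume "Ls \<in> ?A \<union> ?B"
  then show "Ls \<in> block_cuts k (x # y # P)"
  proof
    assume "Ls \<in> ?A"
    then show ?thesis by (auto simp: block_cuts_def)
  next
    assume "Ls \<in> ?B"
    then obtain Ms where Ms: "y < x" "k > 0" "Ms \<in> block_cuts (k - 1) (y # P)"
      "Ls = (x # hd Ms) # tl Ms" by (auto split: if_splits)
    then obtain M Ms' where M: "Ms = M # Ms'" by (cases Ms) (auto simp: block_cuts_def)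
    with Ms obtain M' where "M = y # M'" by (cases M) (auto simp: block_cuts_def)
    with M Ms show ?thesis by (auto simp: block_cuts_def)
  qed
qed

text \<open>A cutting amounts to a choice of \<open>k\<close> ascents to leave uncut. In the
  induction, the two ways of treating the first letter give Pascal's rule.\<close>

lemma card_block_cuts: "card (block_cuts k P) = card (ascents P) choose k"
proof (induction P arbitrary: k rule: induct_list012)
  case 1
  have "block_cuts k [] = (if k = 0 then {[]} else {})"
    by (auto simp: block_cuts_def)
  then show ?case by (cases k) (auto simp: ascents_def)
next
  case (2 x)
  have "Ls = [[x]]" if "concat Ls = [x]" "decreasing_blocks Ls" for Ls
    using that by (cases Ls; cases "hd Ls"; cases "tl Ls"; cases "hd (tl Ls)") (auto simp: append_eq_Cons_conv)
  then have "decreasing_blocks Ls \<and> concat Ls = [x] \<longleftrightarrow> Ls = [[x]]" for Ls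
    by (metis concat.simps append_Nil2 decreasing_blocks_simps(1,2) list.distinct(1) sorted_wrt1)
  then have "block_cuts k [x] = {Ls. Ls = [[x]] \<and> length Ls + k = 1}"
    unfolding block_cuts_def conj_assoc[symmetric] by simp
  also have "\<dots> = (if k = 0 then {[[x]]} else {})"
    by auto
  finally have "block_cuts k [x] = (if k = 0 then {[[x]]} else {})" .
  moreover have "ascents [x] = {}" by (auto simp: ascents_def)
  ultimately show ?case by (cases k) auto
next
  case (3 x y P)
  let ?f = "\<lambda>Ls. (x # hd Ls) # tl Ls"
  \<comment> \<open>Deleting the first letter of the first block undoes the joining.\<close>
  have inj: "inj_on ?f (block_cuts j (y # P))" for j
    by (rule inj_on_inverseI[where g = "\<lambda>Ls. tl (hd Ls) # tl Ls"])
       (auto simp: block_cuts_def neq_Nil_conv intro!: list.collapse)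
  have disj: "(#) [x] ` block_cuts k (y # P) \<inter> ?f ` block_cuts j (y # P) = {}" for j
  proof -
    \<comment> \<open>After joining, the first block has at least two letters, so it differs from
      \<open>[x]\<close>.\<close>
    have "hd Ls \<noteq> []" if "Ls \<in> block_cuts j (y # P)" for Ls
      using that by (cases Ls) (auto simp: block_cuts_def)
    then show ?thesis by fastforce
  qed
  show ?case
  proof (cases "y < x \<and> k > 0")
    case True
    then obtain k' where "k = Suc k'" by (cases k) auto
    with True show ?thesis
      using disj[of "k - 1"]
      by (simp add: block_cuts_Cons_Cons card_Un_disjoint card_image inj 3(2) card_ascents_Cons_Cons)
  next
    case False
    then have "block_cuts k (x # y # P) = (#) [x] ` block_cuts k (y # P)"
      by (simp only: block_cuts_Cons_Cons if_False Un_empty_right)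
    then have "card (block_cuts k (x # y # P)) = card (ascents (y # P)) choose k"
      by (simp add: card_image 3(2))
    with False show ?thesis by (auto simp: card_ascents_Cons_Cons)
  qed
qed

section \<open>Lattice paths in terms of blocks\<close>

lemma path_end_eq_count: "path_end P r = int (count_list P r)"
  by (induction P) (auto simp: path_end_def unit_step_def)

lemma count_list_decreasing:
  "sorted_wrt (>) L \<Longrightarrow> count_list L (r :: nat) = (if r \<in> set L then 1 else 0)"
  by (induction L) auto

lemma count_list_take_le: "count_list (take q L) r \<le> count_list L r"
  by (metis append_take_drop_id count_list_append le_add1)

text \<open>Within a decreasing block the step \<open>Suc r\<close> comes before the step \<open>r\<close>, so the latter cannot
  compensate for the former.\<close>

lemma prefix_dominance_iff_block_dominance:
  assumes "decreasing_blocks Ls"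
  shows "(\<forall>q. count_list (take q (concat Ls)) (Suc r) \<le> count_list (take q (concat Ls)) r) \<longleftrightarrow>
    (\<forall>v<length Ls. count_list (concat (take (Suc v) Ls)) (Suc r) \<le> count_list (concat (take v Ls)) r)"
    (is "?L Ls \<longleftrightarrow> ?R Ls")
  using assms
proof (induction Ls rule: rev_induct)
  case (snoc L Ls)
  let ?P = "concat Ls"
  have dec: "sorted_wrt (>) L" using snoc.prems by simp
  \<comment> \<open>A prefix of the longer word is a prefix of \<open>?P\<close>, or
    \<open>?P\<close> followed by a prefix of \<open>L\<close>.\<close>
  have "?L (Ls @ [L]) \<longleftrightarrow> ?L Ls \<and>
    (\<forall>q. count_list ?P (Suc r) + count_list (take q L) (Suc r) \<le> count_list ?P r + count_list (take q L) r)"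
    (is "_ \<longleftrightarrow> _ \<and> ?Q")
  proof (intro iffI conjI allI)
    fix q assume *: "?L (Ls @ [L])"
    from *[rule_format, of "min q (length ?P)"]
    show "count_list (take q ?P) (Suc r) \<le> count_list (take q ?P) r"
      by (cases "q \<le> length ?P") auto
    from *[rule_format, of "length ?P + q"]
    show "count_list ?P (Suc r) + count_list (take q L) (Suc r) \<le> count_list ?P r + count_list (take q L) r"
      by simp
  next
    fix q assume *: "?L Ls \<and> ?Q"
    show "count_list (take q (concat (Ls @ [L]))) (Suc r) \<le> count_list (take q (concat (Ls @ [L]))) r"
      using * by (cases "q \<le> length ?P") auto
  qed
  also have "\<dots> \<longleftrightarrow> ?L Ls \<and> count_list ?P (Suc r) + count_list L (Suc r) \<le> count_list ?P r" (is "_ \<longleftrightarrow> _ \<and> ?S")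
  proof -
    have "?Q \<longleftrightarrow> ?S"
    proof
      assume Q: ?Q
      show ?S
      proof (cases "Suc r \<in> set L")
        case True
        \<comment> \<open>The sharpest inequality comes from the prefix of \<open>L\<close> ending
          in \<open>Suc r\<close>: it has the new \<open>Suc r\<close> but no \<open>r\<close>
          yet.\<close>
        then obtain xs ys where L: "L = xs @ Suc r # ys" by (auto simp: in_set_conv_decomp)
        with dec have "count_list xs r = 0" "count_list xs (Suc r) = 0" "count_list ys (Suc r) = 0"
          by (auto simp: sorted_wrt_append count_list_0_iff)
        then show ?thesis using Q[rule_format, of "Suc (length xs)"] by (simp add: L)
      next
        case False
        then show ?thesis using Q[rule_format, of 0] by (simp add: count_list_0_iff)
      qed
    next
      assume S: ?S
      show ?Q
      proof
        fix q show "count_list ?P (Suc r) + count_list (take q L) (Suc r) \<le> count_list ?P r + count_list (take q L) r"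
          using S count_list_take_le[of q L "Suc r"] by linarith
      qed
    qed
    then show ?thesis by blast
  qed
  also have "\<dots> \<longleftrightarrow> ?R Ls \<and> ?S" using snoc by simp
  also have "\<dots> \<longleftrightarrow> ?R (Ls @ [L])" by (auto simp: less_Suc_eq)
  finally show ?case .
qed simp

text \<open>Coordinates are letter counts, hence nonnegative, and only their order remains to be
  checked. The shift from \<open>v\<close> to \<open>Suc v\<close> in the last conjunct will become
  strictness of columns.\<close>

lemma lattice_paths_concat_iff:
  assumes "decreasing_blocks Ls"
  shows "concat Ls \<in> lattice_paths m n \<longleftrightarrow>
    set (concat Ls) \<subseteq> {1..m} \<and> (\<forall>r\<in>{1..m}. count_list (concat Ls) r = n) \<and>
    (\<forall>r\<in>{1..<m}. \<forall>v<length Ls.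
       count_list (concat (take (Suc v) Ls)) (Suc r) \<le> count_list (concat (take v Ls)) r)"
proof -
  let ?P = "concat Ls"
  have "(\<forall>i\<le>length ?P. in_region m (path_end (take i ?P))) \<longleftrightarrow>
    (\<forall>r\<in>{1..<m}. \<forall>q\<le>length ?P. count_list (take q ?P) (Suc r) \<le> count_list (take q ?P) r)"
    by (auto simp: in_region_def path_end_eq_count)
  also have "\<dots> \<longleftrightarrow> (\<forall>r\<in>{1..<m}. \<forall>q. count_list (take q ?P) (Suc r) \<le> count_list (take q ?P) r)"
    by (metis nle_le order_refl take_all)
  finally show ?thesis
    unfolding lattice_paths_def
    by (auto simp: path_end_eq_count prefix_dominance_iff_block_dominance[OF assms])
qed

lemma length_lattice_path:
  assumes "P \<in> lattice_paths m n"
  shows "length P = m * n"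
proof -
  have "length P = (\<Sum>r\<in>set P. count_list P r)" by (simp add: sum_count_set)
  also have "\<dots> = (\<Sum>r\<in>{1..m}. count_list P r)"
    using assms by (intro sum.mono_neutral_left) (auto simp: lattice_paths_def count_list_0_iff)
  also have "\<dots> = m * n" using assms by (simp add: lattice_paths_def path_end_eq_count)
  finally show ?thesis .
qed

lemma finite_lattice_paths: "finite (lattice_paths m n)"
  by (rule finite_subset[OF _ finite_lists_length_eq[of "{1..m}" "m * n"]])
     (auto simp: length_lattice_path, auto simp: lattice_paths_def)

text \<open>The objects counted in two ways: a path with a cutting of it, stored as the blocks alone
  because the path is their concatenation.\<close>

definition blocked_paths :: "nat \<Rightarrow> nat \<Rightarrow> nat \<Rightarrow> nat list list set" where
  "blocked_paths k m n =
     {Ls. decreasing_blocks Ls \<and> concat Ls \<in> lattice_paths m n \<and> length Ls + k = m * n}"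

lemma blocked_paths_eq_UN: "blocked_paths k m n = (\<Union>P\<in>lattice_paths m n. block_cuts k P)"
  by (auto simp: blocked_paths_def block_cuts_def length_lattice_path)

lemma card_blocked_paths:
  "card (blocked_paths k m n) = (\<Sum>P\<in>lattice_paths m n. card (ascents P) choose k)"
  unfolding blocked_paths_eq_UN
  by (subst card_UN_disjoint)
     (auto simp: finite_lattice_paths card_block_cuts, auto simp: block_cuts_def)

section \<open>Rectangular increasing tableaux\<close>

definition rect_cells :: "nat \<Rightarrow> nat \<Rightarrow> (nat \<times> nat) set" where
  "rect_cells m n = {..<m} \<times> {..<n}"

lemma young_diagram_replicate: "young_diagram (replicate m n) = rect_cells m n"
  by (auto simp: young_diagram_def rect_cells_def)

text \<open>For positive fillings, having no gaps and having a prescribed maximum together fix the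
  set of entries. The conjunct \<open>k \<le> m * n\<close> is kept because \<open>m * n - k\<close>
  is truncated.\<close>

lemma Inc_rect_iff:
  "T \<in> Inc_rect k m n \<longleftrightarrow>
     T \<in> rect_cells m n \<rightarrow>\<^sub>E {1..} \<and>
     (\<forall>i<m. \<forall>j'<n. \<forall>j<j'. T (i, j) < T (i, j')) \<and>
     (\<forall>i'<m. \<forall>i<i'. \<forall>j<n. T (i, j) < T (i', j)) \<and>
     k \<le> m * n \<and> T ` rect_cells m n = {1..m * n - k}"
proof -
  let ?E = "T ` rect_cells m n"
  have fin: "finite ?E" by (simp add: rect_cells_def)
  \<comment> \<open>The inserted 0 is the maximum exactly when the interval is empty.\<close>
  have max: "Max (insert 0 {1..M :: nat}) = M" for M
    by (intro Max_eqI) auto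
  have ent: "((\<forall>v. 1 \<le> v \<and> v \<le> Max (insert 0 ?E) \<longrightarrow> v \<in> ?E) \<and> Max (insert 0 ?E) + k = m * n) \<longleftrightarrow>
     k \<le> m * n \<and> ?E = {1..m * n - k}" (is "?L \<longleftrightarrow> ?R")
    if T: "T \<in> rect_cells m n \<rightarrow>\<^sub>E {1..}"
  proof
    assume L: ?L
    then have "Max (insert 0 ?E) = m * n - k" by (metis add_diff_cancel_right')
    moreover have "x \<le> Max (insert 0 ?E)" if "x \<in> ?E" for x
      using fin that by (intro Max_ge) auto
    moreover have "\<forall>x\<in>?E. 1 \<le> x" using T by (force simp: PiE_def Pi_def)
    ultimately show ?R using L by auto
  next
    assume R: ?R
    then show ?L by (simp only: max atLeastAtMost_iff) simp
  qed
  have row: "(\<forall>i j j'. (i, j) \<in> rect_cells m n \<and> (i, j') \<in> rect_cells m n \<and> j < j' \<longrightarrow> T (i, j) < T (i, j'))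
      \<longleftrightarrow> (\<forall>i<m. \<forall>j'<n. \<forall>j<j'. T (i, j) < T (i, j'))"
    by (auto simp: rect_cells_def)
  have col: "(\<forall>i i' j. (i, j) \<in> rect_cells m n \<and> (i', j) \<in> rect_cells m n \<and> i < i' \<longrightarrow> T (i, j) < T (i', j))
      \<longleftrightarrow> (\<forall>i'<m. \<forall>i<i'. \<forall>j<n. T (i, j) < T (i', j))"
    by (auto simp: rect_cells_def)
  show ?thesis
    unfolding Inc_rect_def Inc_def increasing_tableau_def max_entry_def entries_def
      young_diagram_replicate sum_list_replicate mem_Collect_eq row col conj_assoc of_nat_id
    by (rule conj_cong[OF refl], rule conj_cong[OF refl], rule conj_cong[OF refl], erule ent)
qed

text \<open>Entries increase strictly along the first row and then down the last column, a chain of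
  \<open>m + n - 1\<close> cells. So the maximum \<open>m * n - k\<close> is at least
  \<open>m + n - 1\<close>.\<close>

lemma Inc_rect_k_bound:
  assumes T: "T \<in> Inc_rect k m n" and "m \<ge> 1" "n \<ge> 1"
  shows "k \<le> (m - 1) * (n - 1)"
proof -
  have T': "T (0, 0) \<ge> 1"
    using assms by (auto simp: Inc_rect_iff rect_cells_def PiE_def Pi_def)
  have row: "j < n \<Longrightarrow> T (0, j) \<ge> Suc j" for j
  proof (induction j)
    case (Suc j)
    have "T (0, j) < T (0, Suc j)" using assms Suc by (simp add: Inc_rect_iff)
    with Suc show ?case by simp
  qed (use T' in simp)
  have col: "i < m \<Longrightarrow> T (i, n - 1) \<ge> n + i" for i
  proof (induction i)
    case 0
    then show ?case using row[of "n - 1"] \<open>n \<ge> 1\<close> by simp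
  next
    case (Suc i)
    have "T (i, n - 1) < T (Suc i, n - 1)" using assms Suc by (simp add: Inc_rect_iff)
    with Suc show ?case by simp
  qed
  have "T (m - 1, n - 1) \<in> T ` rect_cells m n"
    using assms by (auto simp: rect_cells_def)
  then have "T (m - 1, n - 1) \<le> m * n - k" and "k \<le> m * n" using T by (auto simp: Inc_rect_iff)
  moreover have "n + (m - 1) \<le> T (m - 1, n - 1)" using col[of "m - 1"] \<open>m \<ge> 1\<close> by simp
  ultimately have "n + (m - 1) + k \<le> m * n" by linarith
  moreover obtain a b where "m = Suc a" "n = Suc b" using assms by (metis Suc_le_D One_nat_def)
  ultimately show ?thesis by (simp add: algebra_simps)
qed

section \<open>The correspondence between tableaux and blocked paths\<close>

text \<open>Rows are renumbered from 1 here, to serve as letters of a path.\<close>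

definition rows_with_entry :: "nat \<Rightarrow> nat \<Rightarrow> (nat \<times> nat \<Rightarrow> nat) \<Rightarrow> nat \<Rightarrow> nat set" where
  "rows_with_entry m n T v = {r \<in> {1..m}. \<exists>j<n. T (r - 1, j) = v}"

definition tableau_blocks :: "nat \<Rightarrow> nat \<Rightarrow> nat \<Rightarrow> (nat \<times> nat \<Rightarrow> nat) \<Rightarrow> nat list list" where
  "tableau_blocks k m n T =
     map (\<lambda>v. rev (sorted_list_of_set (rows_with_entry m n T (Suc v)))) [0..<m * n - k]"

lemma finite_rows_with_entry [simp]: "finite (rows_with_entry m n T v)"
  by (simp add: rows_with_entry_def)

lemma length_tableau_blocks [simp]: "length (tableau_blocks k m n T) = m * n - k"
  by (simp add: tableau_blocks_def)

section \<open>From tableaux to blocked paths\<close>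

lemma decreasing_tableau_blocks:
  assumes "T \<in> Inc_rect k m n"
  shows "decreasing_blocks (tableau_blocks k m n T)"
proof -
  \<comment> \<open>Blocks are nonempty because every value up to \<open>m * n - k\<close> occurs in
    \<open>T\<close>.\<close>
  have "rows_with_entry m n T (Suc v) \<noteq> {}" if "v < m * n - k" for v
  proof -
    have "Suc v \<in> T ` rect_cells m n" using assms that by (simp add: Inc_rect_iff)
    then obtain i j where "i < m" "j < n" "T (i, j) = Suc v" by (auto simp: rect_cells_def)
    then have "Suc i \<in> rows_with_entry m n T (Suc v)" by (auto simp: rows_with_entry_def)
    then show ?thesis by blast
  qed
  then show ?thesis
    by (auto simp: decreasing_blocks_def tableau_blocks_def sorted_wrt_rev)
qed

text \<open>Entries of a row are distinct, so each block has at most one letter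
  \<open>Suc i\<close>, recording the cell of row \<open>i\<close> with that entry. This translates
  between path coordinates and tableau entries.\<close>

lemma count_tableau_blocks:
  assumes T: "T \<in> Inc_rect k m n" and "v \<le> m * n - k" and i: "i < m"
  shows "count_list (concat (take v (tableau_blocks k m n T))) (Suc i) = card {j. j < n \<and> T (i, j) \<le> v}"
  using assms(2)
proof (induction v)
  case 0
  have "{j. j < n \<and> T (i, j) \<le> 0} = {}"
    using T i by (force simp: Inc_rect_iff rect_cells_def PiE_def Pi_def)
  then show ?case by simp
next
  case (Suc v)
  have less: "T (i, j) < T (i, j')" if "j < j'" "j' < n" for j j'
    using T i that by (simp add: Inc_rect_iff)
  have uniq: "j = j'" if "j < n" "j' < n" "T (i, j) = T (i, j')" for j j'
    using less[of j j'] less[of j' j] that by (metis less_irrefl nat_neq_iff)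
  have "count_list (tableau_blocks k m n T ! v) (Suc i) = (if \<exists>j<n. T (i, j) = Suc v then 1 else 0)"
    using Suc.prems i
    by (subst count_list_decreasing)
       (auto simp: tableau_blocks_def sorted_wrt_rev rows_with_entry_def)
  also have "\<dots> = card {j. j < n \<and> T (i, j) = Suc v}"
  proof (cases "\<exists>j<n. T (i, j) = Suc v")
    case True
    then obtain j where "j < n" "T (i, j) = Suc v" by blast
    then have "{j. j < n \<and> T (i, j) = Suc v} = {j}" using uniq by auto
    with True show ?thesis by simp
  next
    case False
    then have "{j. j < n \<and> T (i, j) = Suc v} = {}" by blast
    with False show ?thesis by (simp only: card.empty if_False)
  qed
  finally have "count_list (concat (take (Suc v) (tableau_blocks k m n T))) (Suc i) =
      card {j. j < n \<and> T (i, j) \<le> v} + card {j. j < n \<and> T (i, j) = Suc v}"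
    using Suc by (simp add: take_Suc_conv_app_nth)
  also have "\<dots> = card ({j. j < n \<and> T (i, j) \<le> v} \<union> {j. j < n \<and> T (i, j) = Suc v})"
    by (subst card_Un_disjoint) auto
  also have "{j. j < n \<and> T (i, j) \<le> v} \<union> {j. j < n \<and> T (i, j) = Suc v} = {j. j < n \<and> T (i, j) \<le> Suc v}"
    by auto
  finally show ?case .
qed

lemma tableau_blocks_in_blocked_paths:
  assumes T: "T \<in> Inc_rect k m n"
  shows "tableau_blocks k m n T \<in> blocked_paths k m n"
proof -
  let ?Ls = "tableau_blocks k m n T"
  have le: "T (i, j) \<le> m * n - k" if "i < m" "j < n" for i j
  proof -
    have "T (i, j) \<in> T ` rect_cells m n" using that by (auto simp: rect_cells_def)
    then show ?thesis using T by (simp add: Inc_rect_iff)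
  qed
  have "count_list (concat ?Ls) r = n" if "r \<in> {1..m}" for r
  proof -
    have "{j. j < n \<and> T (r - 1, j) \<le> m * n - k} = {..<n}" using le[of "r - 1"] that by auto
    then show ?thesis using count_tableau_blocks[OF T le_refl, of "r - 1"] that
      by (cases r) simp_all
  qed
  moreover have "set (concat ?Ls) \<subseteq> {1..m}" by (auto simp: tableau_blocks_def rows_with_entry_def)
  moreover have "count_list (concat (take (Suc v) ?Ls)) (Suc r) \<le> count_list (concat (take v ?Ls)) r"
    if r: "r \<in> {1..<m}" and v: "v < length ?Ls" for r v
  proof -
    \<comment> \<open>Letters \<open>r\<close> and \<open>Suc r\<close> stand for tableau rows
      \<open>r - 1\<close> and \<open>r\<close>. A cell with entry at most \<open>Suc v\<close> has
      an entry at most \<open>v\<close> directly above it.\<close>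
    have col: "T (r - 1, j) < T (r, j)" if "j < n" for j
      using T r that by (simp add: Inc_rect_iff)
    have "card {j. j < n \<and> T (r, j) \<le> Suc v} \<le> card {j. j < n \<and> T (r - 1, j) \<le> v}"
      using col by (intro card_mono) (auto, fastforce)
    then show ?thesis
      using count_tableau_blocks[OF T, of "Suc v" r] count_tableau_blocks[OF T, of v "r - 1"] r v
      by (cases r) simp_all
  qed
  moreover have "length ?Ls + k = m * n" using T by (simp add: Inc_rect_iff)
  ultimately show ?thesis
    using decreasing_tableau_blocks[OF T] by (simp add: blocked_paths_def lattice_paths_concat_iff)
qed

section \<open>Recovering a tableau from its blocks\<close>

text \<open>Since rows increase, the cells of a row with entry at most \<open>v\<close> form an
  initial segment, determined by its length. Thus letter counts determine the entries.\<close>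

lemma tableau_le_iff:
  assumes T: "T \<in> Inc_rect k m n" and "i < m" "j < n"
  shows "T (i, j) \<le> v \<longleftrightarrow> j < card {j. j < n \<and> T (i, j) \<le> v}"
proof -
  have mono: "T (i, a) \<le> T (i, b)" if "a \<le> b" "b < n" for a b
    using assms that by (cases "a = b") (auto simp: Inc_rect_iff intro: less_imp_le)
  show ?thesis
  proof
    assume "T (i, j) \<le> v"
    then have "{..j} \<subseteq> {j. j < n \<and> T (i, j) \<le> v}" using mono[of _ j] \<open>j < n\<close> by fastforce
    then have "card {..j} \<le> card {j. j < n \<and> T (i, j) \<le> v}" by (intro card_mono) auto
    then show "j < card {j. j < n \<and> T (i, j) \<le> v}" by simp
  next
    assume *: "j < card {j. j < n \<and> T (i, j) \<le> v}"
    show "T (i, j) \<le> v"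
    proof (rule ccontr)
      assume "\<not> T (i, j) \<le> v"
      then have "{j. j < n \<and> T (i, j) \<le> v} \<subseteq> {..<j}"
        using mono[of j] by (auto simp: not_le) (meson leD le_trans not_le)
      then have "card {j. j < n \<and> T (i, j) \<le> v} \<le> card {..<j}" by (intro card_mono) auto
      with * show False by simp
    qed
  qed
qed

lemma inj_on_tableau_blocks: "inj_on (tableau_blocks k m n) (Inc_rect k m n)"
proof (rule inj_onI)
  fix T T' assume T: "T \<in> Inc_rect k m n" and T': "T' \<in> Inc_rect k m n"
    and eq: "tableau_blocks k m n T = tableau_blocks k m n T'"
  have iff: "T (i, j) \<le> v \<longleftrightarrow> T' (i, j) \<le> v" if "v \<le> m * n - k" "i < m" "j < n" for i j v
    using tableau_le_iff[OF T, of i j v] tableau_le_iff[OF T', of i j v]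
      count_tableau_blocks[OF T, of v i] count_tableau_blocks[OF T', of v i] eq that by simp
  have "T (i, j) = T' (i, j)" if "i < m" "j < n" for i j
  proof -
    have "T (i, j) \<in> T ` rect_cells m n" "T' (i, j) \<in> T' ` rect_cells m n"
      using that by (auto simp: rect_cells_def)
    then have "T (i, j) \<le> m * n - k" "T' (i, j) \<le> m * n - k" using T T' by (auto simp: Inc_rect_iff)
    \<comment> \<open>Each of the two entries is a legitimate value of \<open>v\<close>, which gives
      both inequalities.\<close>
    then show ?thesis using iff that by (meson le_antisym order_refl)
  qed
  then show "T = T'"
    using T T' by (intro PiE_ext[of T "rect_cells m n" "\<lambda>_. {1..}"]) (auto simp: Inc_rect_iff rect_cells_def)
qed

lemma tableau_blocks_surj:
  assumes Ls: "Ls \<in> blocked_paths k m n"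
  shows "\<exists>T\<in>Inc_rect k m n. tableau_blocks k m n T = Ls"
proof -
  \<comment> \<open>\<open>c i v\<close> is the intended number of cells of row \<open>i\<close>
    with entry at most \<open>v\<close>.\<close>
  define c where "c i v = count_list (concat (take v Ls)) (Suc i)" for i v
  \<comment> \<open>\<open>tableau_le_iff\<close> forces this choice: the entry in column
    \<open>j\<close> is the first \<open>v\<close> for which row \<open>i\<close> has more than
    \<open>j\<close> cells. Outside the rectangle, \<open>undefined\<close> makes \<open>T\<close>
    extensional.\<close>
  define T where
    "T = (\<lambda>x. if x \<in> rect_cells m n then LEAST v. snd x < c (fst x) v else undefined)"
  have dec: "decreasing_blocks Ls" and len: "length Ls = m * n - k" and k: "k \<le> m * n"
    using Ls by (auto simp: blocked_paths_def)
  have paths: "concat Ls \<in> lattice_paths m n" using Ls by (simp add: blocked_paths_def)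
  note P = paths[unfolded lattice_paths_concat_iff[OF dec]]
  have c_0: "c i 0 = 0" for i by (simp add: c_def)
  have c_Suc: "c i (Suc v) = c i v + (if Suc i \<in> set (Ls ! v) then 1 else 0)" if "v < length Ls" for i v
  proof -
    have "sorted_wrt (>) (Ls ! v)" using dec that by (auto simp: decreasing_blocks_def)
    then show ?thesis
      using that by (simp add: c_def take_Suc_conv_app_nth count_list_decreasing)
  qed
  have c_top: "c i v = n" if "i < m" "v \<ge> length Ls" for i v
    using P that by (simp add: c_def)
  have c_mono: "c i v \<le> c i w" if "v \<le> w" for i v w
    using that
  proof (induction w rule: dec_induct)
    case (step w)
    then show ?case by (cases "w < length Ls") (simp_all add: c_Suc, simp add: c_def)
  qed simp
  have c_col: "c (Suc i) (Suc v) \<le> c i v" if "Suc i < m" "v < length Ls" for i v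
    using P that by (simp add: c_def)
  have T_le: "T (i, j) \<le> v \<longleftrightarrow> j < c i v" if "i < m" "j < n" for i j v
  proof -
    have T: "T (i, j) = (LEAST v. j < c i v)" using that by (simp add: T_def rect_cells_def)
    have "j < c i (length Ls)" using that by (simp add: c_top)
    then have "j < c i (T (i, j))" unfolding T by (rule LeastI)
    then show ?thesis using c_mono[of "T (i, j)" v i] by (auto simp: T intro: Least_le)
  qed
  have T_pos: "T (i, j) \<noteq> 0" if "i < m" "j < n" for i j
    using T_le[OF that, of 0] by (simp add: c_0)
  have T_top: "T (i, j) \<le> length Ls" if "i < m" "j < n" for i j
    using that by (simp add: T_le c_top)
  \<comment> \<open>Reading block \<open>v\<close> puts \<open>Suc v\<close> into the next free
    column, \<open>c i v\<close>, of each row whose letter occurs in it.\<close>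
  have T_eq: "T (i, j) = Suc v \<longleftrightarrow> Suc i \<in> set (Ls ! v) \<and> j = c i v"
    if "i < m" "j < n" "v < length Ls" for i j v
  proof -
    have "T (i, j) = Suc v \<longleftrightarrow> T (i, j) \<le> Suc v \<and> \<not> T (i, j) \<le> v" by auto
    also have "\<dots> \<longleftrightarrow> Suc i \<in> set (Ls ! v) \<and> j = c i v" using that by (auto simp: T_le c_Suc)
    finally show ?thesis .
  qed
  have row: "T (i, j) < T (i, j')" if ij: "i < m" "j' < n" "j < j'" for i j j'
  proof -
    obtain v where v: "T (i, j') = Suc v" using T_pos[of i j'] ij by (cases "T (i, j')") auto
    then have "v < length Ls" using T_top[of i j'] that by simp
    then have "j' = c i v" using T_eq v that by blast
    then have "T (i, j) \<le> v" using that by (simp add: T_le)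
    then show ?thesis using v by simp
  qed
  have col1: "T (i, j) < T (Suc i, j)" if ij: "Suc i < m" "j < n" for i j
  proof -
    obtain v where v: "T (Suc i, j) = Suc v" using T_pos[of "Suc i" j] ij by (cases "T (Suc i, j)") auto
    then have "v < length Ls" using T_top[of "Suc i" j] that by simp
    \<comment> \<open>Column \<open>j\<close> of the lower row is filled after \<open>Suc v\<close>
      blocks; \<open>c_col\<close> then says that the cell above was filled after \<open>v\<close>
      blocks.\<close>
    moreover have "j < c (Suc i) (Suc v)" using T_le[of "Suc i" j "Suc v"] v that by simp
    ultimately have "T (i, j) \<le> v" using c_col[of i v] that by (simp add: T_le)
    then show ?thesis using v by simp
  qed
  have col: "T (i, j) < T (i', j)" if "i < i'" "i' < m" "j < n" for i i' j
    using that
  proof (induction i')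
    case (Suc i')
    then show ?case using col1[of i' j] by (cases "i = i'") auto
  qed simp
  have "T ` rect_cells m n = {1..length Ls}"
  proof (intro equalityI subsetI)
    fix v assume "v \<in> T ` rect_cells m n"
    then obtain i j where ij: "i < m" "j < n" "v = T (i, j)" by (auto simp: rect_cells_def)
    then show "v \<in> {1..length Ls}" using T_pos[of i j] T_top[of i j] by simp
  next
    fix v' assume "v' \<in> {1..length Ls}"
    then obtain v where v: "v' = Suc v" "v < length Ls" by (cases v') auto
    then have "Ls ! v \<noteq> []" "set (Ls ! v) \<subseteq> set (concat Ls)"
      using dec nth_mem[OF v(2)] by (auto simp: decreasing_blocks_def simp del: nth_mem)
    then obtain r where "r \<in> set (Ls ! v)" "r \<in> {1..m}" using P by (metis hd_in_set subsetD)
    then obtain i where i: "Suc i \<in> set (Ls ! v)" "i < m"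
      by (intro that[of "r - 1"]) auto
    \<comment> \<open>Row \<open>i\<close> receives a cell from block \<open>v\<close> and never
      exceeds \<open>n\<close> cells, so the new cell \<open>(i, c i v)\<close> lies in the
      rectangle.\<close>
    have "c i (Suc v) \<le> n" using c_mono[of "Suc v" "length Ls" i] c_top[of i "length Ls"] i v by simp
    then have j: "c i v < n" using i v by (simp add: c_Suc)
    then have "T (i, c i v) = v'" using T_eq i v by simp
    then show "v' \<in> T ` rect_cells m n" using i j by (force simp: rect_cells_def)
  qed
  moreover have "T \<in> rect_cells m n \<rightarrow>\<^sub>E {1..}"
  proof (rule PiE_I)
    fix x assume "x \<in> rect_cells m n"
    then show "T x \<in> {1..}" using T_pos by (force simp: rect_cells_def Suc_le_eq)
  qed (simp add: T_def)
  ultimately have T: "T \<in> Inc_rect k m n"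
    using row col k by (simp add: Inc_rect_iff len)
  have "tableau_blocks k m n T = Ls"
  proof (rule nth_equalityI)
    fix v assume "v < length (tableau_blocks k m n T)"
    then have v: "v < length Ls" by (simp add: len)
    have sub: "set (Ls ! v) \<subseteq> {1..m}" using P nth_mem[OF v] by auto
    have "rows_with_entry m n T (Suc v) = set (Ls ! v)"
    proof (intro equalityI subsetI)
      fix r assume "r \<in> rows_with_entry m n T (Suc v)"
      then obtain i j where "r = Suc i" "i < m" "j < n" "T (i, j) = Suc v"
        by (cases r) (auto simp: rows_with_entry_def)
      then show "r \<in> set (Ls ! v)" using T_eq v by blast
    next
      fix r assume r: "r \<in> set (Ls ! v)"
      then obtain i where i: "r = Suc i" "i < m"
        using sub by (intro that[of "r - 1"]) force+
      have "c i (Suc v) \<le> n" using c_mono[of "Suc v" "length Ls" i] c_top[of i "length Ls"] i v by simp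
      then have "c i v < n" using i r v by (simp add: c_Suc)
      then show "r \<in> rows_with_entry m n T (Suc v)"
        using T_eq[of i "c i v" v] i r v by (auto simp: rows_with_entry_def)
    qed
    \<comment> \<open>A strictly decreasing block is determined by its set of letters.\<close>
    moreover have "rev (sorted_list_of_set (set (Ls ! v))) = Ls ! v"
    proof -
      have "sorted_wrt (>) (Ls ! v)" using dec v by (auto simp: decreasing_blocks_def)
      then have "sorted_wrt (<) (rev (Ls ! v))" by (simp add: sorted_wrt_rev)
      then have "sorted_list_of_set (set (rev (Ls ! v))) = rev (Ls ! v)"
        by (metis sorted_list_of_set.idem_if_sorted_distinct strict_sorted_iff)
      then show ?thesis by simp
    qed
    ultimately show "tableau_blocks k m n T ! v = Ls ! v"
      using v by (simp add: tableau_blocks_def len)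
  qed (simp add: len)
  with T show ?thesis by blast
qed

lemma bij_betw_tableau_blocks:
  "bij_betw (tableau_blocks k m n) (Inc_rect k m n) (blocked_paths k m n)"
  using inj_on_tableau_blocks tableau_blocks_in_blocked_paths tableau_blocks_surj
  by (fastforce simp: bij_betw_def)

section \<open>Counting paths by their number of ascents\<close>

text \<open>Leaving all ascents uncut gives a blocked path, and the tableau corresponding to it
  obeys \<open>Inc_rect_k_bound\<close>.\<close>

lemma card_ascents_le:
  assumes "P \<in> lattice_paths m n" "m \<ge> 1" "n \<ge> 1"
  shows "card (ascents P) \<le> (m - 1) * (n - 1)"
proof -
  have "card (block_cuts (card (ascents P)) P) = 1" by (simp add: card_block_cuts)
  then obtain Ls where "Ls \<in> block_cuts (card (ascents P)) P" by (metis card_1_singletonE singletonI)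
  then have "Ls \<in> blocked_paths (card (ascents P)) m n" using assms by (auto simp: blocked_paths_eq_UN)
  then show ?thesis using tableau_blocks_surj Inc_rect_k_bound assms by blast
qed

theorem theorem2p4:
  fixes m n k :: nat
  assumes "m \<ge> 2" and "n \<ge> 1"
  shows "card (Inc_rect k m n) =
    (\<Sum>l = k..(m - 1) * (n - 1). (l choose k) * narayana m n l)"
proof -
  let ?b = "(m - 1) * (n - 1)"
  have "card (Inc_rect k m n) = (\<Sum>P\<in>lattice_paths m n. card (ascents P) choose k)"
    using bij_betw_same_card[OF bij_betw_tableau_blocks] by (simp add: card_blocked_paths)
  \<comment> \<open>Paths are grouped by their number of ascents; \<open>card_ascents_le\<close>
    ensures that no path is missed.\<close>
  also have "\<dots> = (\<Sum>l\<in>{..?b}. \<Sum>P | P \<in> lattice_paths m n \<and> card (ascents P) = l. card (ascents P) choose k)"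
    using assms card_ascents_le[of _ m n]
    by (intro sum.group[symmetric]) (auto simp: finite_lattice_paths)
  also have "\<dots> = (\<Sum>l\<in>{..?b}. (l choose k) * narayana m n l)"
    by (simp add: narayana_def mult.commute)
  \<comment> \<open>The terms with \<open>l < k\<close> vanish with their binomial
    coefficients.\<close>
  also have "\<dots> = (\<Sum>l = k..?b. (l choose k) * narayana m n l)"
    by (intro sum.mono_neutral_right) auto
  finally show ?thesis .
qed

end
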